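(* Let $(W,S)$ be a finite Coxeter system, $Q=q_1\cdots q_m$ a word on $S$, and $\rho\in W$. Let $I$ be a facet of $\mathcal{SC}(Q,\rho)$. If $I\ne\mathsf N(Q,\rho)$, then the father of $I$ in the positive sink tree $\mathcal P^*(Q,\rho)$ is obtained from $I$ by flipping the smallest position in $I\setminus\mathsf N(Q,\rho)$. Similarly, if $I\neq\mathsf P(Q,\rho)$, then the father of $I$ in the negative source tree $\mathcal N(Q,\rho)$ is obtained from $I$ by flipping the largest position in $I\setminus\mathsf P(Q,\rho)$.
   Context: Let $(W,S)$ be a finite Coxeter system with length function $\ell$, let $Q=q_1q_2\cdots q_m$ be a word in the letters $S$, and let $\rho\in W$. Write $[m]=\{1,\dots,m\}$. The subword complex $\mathcal{SC}(Q,\rho)$ is the simplicial complex whose facets are the sets $I\subseteq[m]$ such that the letters of $Q$ at the positions in $[m]\setminus I$, read in increasing order of position, form a reduced expression of $\rho$. Two distinct facets $I,J$ are adjacent if $I\setminus\{i\}=J\setminus\{j\}$ for some $i\in I$, $j\in J$; then $J$ is obtained from $I$ by flipping $i$ (given $I$ and $i$, the facet $J\ne I$ is unique if it exists). The flip is increasing if $i<j$. The increasing flip graph $\mathcal G(Q,\rho)$ is the directed graph whose vertices are the facets of $\mathcal{SC}(Q,\rho)$ and whose edges $I\to J$ are the increasing flips. For an edge $I\to J$ with $I\setminus\{i\}=J\setminus\{j\}$, $i<j$, set $\mathsf p(I\to J)=i$ and $\mathsf n(I\to J)=j$. For $\lambda\in\{\mathsf p,\mathsf n\}$, a path is $\lambda$-rising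 if the sequence of $\lambda$-labels of its successive edges is strictly increasing; whenever there is a directed path from one facet to another, there is a unique $\lambda$-rising path. The positive greedy facet $\mathsf P(Q,\rho)$ is the unique source of $\mathcal G(Q,\rho)$ (the lexicographically smallest facet) and the negative greedy facet $\mathsf N(Q,\rho)$ is the unique sink (the lexicographically largest facet). The positive sink tree $\mathcal P^*(Q,\rho)$ is the spanning tree of $\mathcal G(Q,\rho)$ formed by all $\mathsf p$-rising paths from the facets to $\mathsf N(Q,\rho)$, rooted at $\mathsf N(Q,\rho)$; the father of $I\neq\mathsf N(Q,\rho)$ is the facet following $I$ on the $\mathsf p$-rising path from $I$ to $\mathsf N(Q,\rho)$. The negative source tree $\mathcal N(Q,\rho)$ is the spanning tree formed by all $\mathsf n$-rising paths from $\mathsf P(Q,\rho)$ to the facets, rooted at $\mathsf P(Q,\rho)$; the father of $I\ne\mathsf P(Q,\rho)$ is the facet preceding $I$ on the $\mathsf n$-rising path from $\mathsf P(Q,\rho)$ to $I$. *)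

theory Defs
  imports "HOL-Algebra.Generated_Groups" "Graph_Theory.Graph_Theory"
begin

section \<open>Coxeter systems\<close>

definition word_prod :: "('a, 'b) monoid_scheme \<Rightarrow> 'a list \<Rightarrow> 'a" where
  "word_prod W w = foldr (\<lambda>s x. s \<otimes>\<^bsub>W\<^esub> x) w \<one>\<^bsub>W\<^esub>"

text \<open>The value \<open>M s t = 0\<close> encodes \<open>M s t = \<infinity>\<close>, i.e. no relation between \<open>s\<close> and \<open>t\<close>.\<close>

definition coxeter_matrix :: "'a set \<Rightarrow> ('a \<Rightarrow> 'a \<Rightarrow> nat) \<Rightarrow> bool" where
  "coxeter_matrix S M \<longleftrightarrow>
     (\<forall>s\<in>S. M s s = 1) \<and>
     (\<forall>s\<in>S. \<forall>t\<in>S. M s t = M t s) \<and>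
     (\<forall>s\<in>S. \<forall>t\<in>S. s \<noteq> t \<longrightarrow> M s t = 0 \<or> M s t \<ge> 2)"

text \<open>
  The congruence on words over \<open>S\<close> generated by the relations \<open>(s t) ^ (M s t) = 1\<close>.  The relations
  with \<open>s = t\<close> read \<open>s s = 1\<close> and make every generator its own inverse, so words without
  formal inverses suffice: the quotient of the free monoid on \<open>S\<close> by this congruence is the
  group presented by these generators and relations.
\<close>

inductive coxeter_equiv :: "'a set \<Rightarrow> ('a \<Rightarrow> 'a \<Rightarrow> nat) \<Rightarrow> 'a list \<Rightarrow> 'a list \<Rightarrow> bool"
  for S :: "'a set" and M :: "'a \<Rightarrow> 'a \<Rightarrow> nat" where
  refl: "u \<in> lists S \<Longrightarrow> coxeter_equiv S M u u"
| sym: "coxeter_equiv S M u v \<Longrightarrow> coxeter_equiv S M v u"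
| trans: "coxeter_equiv S M u v \<Longrightarrow> coxeter_equiv S M v w \<Longrightarrow> coxeter_equiv S M u w"
| relation: "u \<in> lists S \<Longrightarrow> v \<in> lists S \<Longrightarrow> s \<in> S \<Longrightarrow> t \<in> S \<Longrightarrow> M s t \<noteq> 0 \<Longrightarrow>
    coxeter_equiv S M (u @ concat (replicate (M s t) [s, t]) @ v) (u @ v)"

text \<open>\<open>(W, S)\<close> is a Coxeter system: \<open>W\<close> is presented by the generators \<open>S\<close> and the relations
  of some Coxeter matrix.\<close>

definition coxeter_system :: "('a, 'b) monoid_scheme \<Rightarrow> 'a set \<Rightarrow> bool" where
  "coxeter_system W S \<longleftrightarrow>
     group W \<and> S \<subseteq> carrier W \<and> generate W S = carrier W \<and>
     (\<exists>M. coxeter_matrix S M \<and>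
        (\<forall>u\<in>lists S. \<forall>v\<in>lists S. word_prod W u = word_prod W v \<longleftrightarrow> coxeter_equiv S M u v))"

definition coxeter_length :: "('a, 'b) monoid_scheme \<Rightarrow> 'a set \<Rightarrow> 'a \<Rightarrow> nat" where
  "coxeter_length W S x = (LEAST n. \<exists>w\<in>lists S. length w = n \<and> word_prod W w = x)"

definition reduced_expression :: "('a, 'b) monoid_scheme \<Rightarrow> 'a set \<Rightarrow> 'a \<Rightarrow> 'a list \<Rightarrow> bool" where
  "reduced_expression W S x w \<longleftrightarrow>
     w \<in> lists S \<and> word_prod W w = x \<and> length w = coxeter_length W S x"

section \<open>Subword complexes and their increasing flip graphs\<close>

text \<open>Positions in a word are numbered from 1, whereas list indexing starts at 0.\<close>

definition subword_at :: "'a list \<Rightarrow> nat set \<Rightarrow> 'a list" where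
  "subword_at Q X = map (\<lambda>k. Q ! (k - 1)) (sorted_list_of_set X)"

definition subword_facets ::
    "('a, 'b) monoid_scheme \<Rightarrow> 'a set \<Rightarrow> 'a list \<Rightarrow> 'a \<Rightarrow> nat set set" where
  "subword_facets W S Q \<rho> =
     {I. I \<subseteq> {1..length Q} \<and> reduced_expression W S \<rho> (subword_at Q ({1..length Q} - I))}"

definition flips_to ::
    "('a, 'b) monoid_scheme \<Rightarrow> 'a set \<Rightarrow> 'a list \<Rightarrow> 'a \<Rightarrow> nat set \<Rightarrow> nat \<Rightarrow> nat set \<Rightarrow> bool" where
  "flips_to W S Q \<rho> I i J \<longleftrightarrow>
     I \<in> subword_facets W S Q \<rho> \<and> J \<in> subword_facets W S Q \<rho> \<and> I \<noteq> J \<and>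
     i \<in> I \<and> (\<exists>j\<in>J. I - {i} = J - {j})"

definition increasing_flip_graph ::
    "('a, 'b) monoid_scheme \<Rightarrow> 'a set \<Rightarrow> 'a list \<Rightarrow> 'a \<Rightarrow> nat set pair_pre_digraph" where
  "increasing_flip_graph W S Q \<rho> =
     \<lparr> pverts = subword_facets W S Q \<rho>,
       parcs = {(I, J). I \<in> subword_facets W S Q \<rho> \<and> J \<in> subword_facets W S Q \<rho> \<and>
                        (\<exists>i\<in>I. \<exists>j\<in>J. I - {i} = J - {j} \<and> i < j)} \<rparr>"

definition p_label :: "nat set \<times> nat set \<Rightarrow> nat" where
  "p_label = (\<lambda>(I, J). THE i. i \<in> I \<and> (\<exists>j\<in>J. I - {i} = J - {j} \<and> i < j))"

definition n_label :: "nat set \<times> nat set \<Rightarrow> nat" where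
  "n_label = (\<lambda>(I, J). THE j. j \<in> J \<and> (\<exists>i\<in>I. I - {i} = J - {j} \<and> i < j))"

definition positive_greedy_facet ::
    "('a, 'b) monoid_scheme \<Rightarrow> 'a set \<Rightarrow> 'a list \<Rightarrow> 'a \<Rightarrow> nat set" where
  "positive_greedy_facet W S Q \<rho> =
     (THE I. I \<in> subword_facets W S Q \<rho> \<and> in_arcs (increasing_flip_graph W S Q \<rho>) I = {})"

definition negative_greedy_facet ::
    "('a, 'b) monoid_scheme \<Rightarrow> 'a set \<Rightarrow> 'a list \<Rightarrow> 'a \<Rightarrow> nat set" where
  "negative_greedy_facet W S Q \<rho> =
     (THE I. I \<in> subword_facets W S Q \<rho> \<and> out_arcs (increasing_flip_graph W S Q \<rho>) I = {})"

section \<open>Rising paths and fathers in the canonical spanning trees\<close>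

text \<open>Paths are given by their lists of arcs; the empty list is the path from a facet to itself.\<close>

definition is_rising_path ::
    "'v pair_pre_digraph \<Rightarrow> ('v \<times> 'v \<Rightarrow> nat) \<Rightarrow> 'v \<Rightarrow> ('v \<times> 'v) list \<Rightarrow> 'v \<Rightarrow> bool" where
  "is_rising_path G l u p v \<longleftrightarrow>
     pre_digraph.apath (with_proj G) u p v \<and> sorted_wrt (<) (map l p)"

definition rising_path ::
    "'v pair_pre_digraph \<Rightarrow> ('v \<times> 'v \<Rightarrow> nat) \<Rightarrow> 'v \<Rightarrow> 'v \<Rightarrow> ('v \<times> 'v) list" where
  "rising_path G l u v = (THE p. is_rising_path G l u p v)"

text \<open>
  The positive sink tree consists of the p-rising paths from all facets to its root, the negative
  greedy facet; the father of a facet \<open>I\<close> is the facet following \<open>I\<close> on the path from \<open>I\<close>, i.e.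
  the head of the first arc.  The negative source tree consists of the n-rising paths from its
  root, the positive greedy facet, to all facets; the father of \<open>I\<close> is the facet preceding \<open>I\<close> on
  the path to \<open>I\<close>, i.e. the tail of the last arc.  Both are meaningful only for \<open>I\<close> not the root.
\<close>

definition positive_sink_father ::
    "('a, 'b) monoid_scheme \<Rightarrow> 'a set \<Rightarrow> 'a list \<Rightarrow> 'a \<Rightarrow> nat set \<Rightarrow> nat set" where
  "positive_sink_father W S Q \<rho> I =
     snd (hd (rising_path (increasing_flip_graph W S Q \<rho>) p_label
                I (negative_greedy_facet W S Q \<rho>)))"

definition negative_source_father ::
    "('a, 'b) monoid_scheme \<Rightarrow> 'a set \<Rightarrow> 'a list \<Rightarrow> 'a \<Rightarrow> nat set \<Rightarrow> nat set" where
  "negative_source_father W S Q \<rho> I =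
     fst (last (rising_path (increasing_flip_graph W S Q \<rho>) n_label
                  (positive_greedy_facet W S Q \<rho>) I))"

end

theory Submission
  imports Defs
begin

text \<open>
  Flipping \<open>i\<close> in a facet \<open>I\<close> exchanges two letters of a reduced word of \<open>\<rho>\<close> that define the same
  reflection, so the exchange condition shows: if \<open>p\<close> is the first position at which two facets
  \<open>I, J\<close> differ and \<open>p \<in> I\<close>, then \<open>I\<close> has an increasing flip at \<open>p\<close>.  As \<open>N\<close>, the negative
  greedy facet, has no increasing flip, the first difference \<open>p\<close> of \<open>I\<close> and \<open>N\<close> lies in \<open>I\<close>, hence
  is \<open>min (I - N)\<close>, and no smaller position of \<open>I\<close> admits an increasing flip.  Flipping \<open>p\<close> moves the
  first difference to the right; iterating gives a rising path to \<open>N\<close>.  A rising path that started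
  with a later flip could never remove \<open>p\<close>.  Reversing the order of positions, which
  replaces \<open>\<rho>\<close> by its inverse, gives the statement for the negative source tree.
\<close>

section \<open>Set families with increasing flips\<close>

text \<open>The order is a parameter so that one argument serves increasing flips and, with the
  order reversed, decreasing ones. The last two assumptions carry all that is taken from Coxeter
  groups: a consequence of the exchange condition, and uniqueness of a flip in a given
  direction.\<close>

locale flip_family =
  fixes F :: "'p set set" and lt :: "'p \<Rightarrow> 'p \<Rightarrow> bool" (infix "\<prec>" 50)
  assumes lt_irrefl: "\<not> x \<prec> x"
    and lt_trans: "x \<prec> y \<Longrightarrow> y \<prec> z \<Longrightarrow> x \<prec> z"
    and lt_total: "x \<noteq> y \<Longrightarrow> x \<prec> y \<or> y \<prec> x"
    and finite_family: "finite F"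
    and finite_member: "I \<in> F \<Longrightarrow> finite I"
    and flip_at_first_difference:
      "I \<in> F \<Longrightarrow> J \<in> F \<Longrightarrow> p \<in> I \<Longrightarrow> p \<notin> J \<Longrightarrow> (\<And>q. q \<prec> p \<Longrightarrow> q \<in> I \<longleftrightarrow> q \<in> J) \<Longrightarrow>
        \<exists>j. p \<prec> j \<and> j \<notin> I \<and> insert j (I - {p}) \<in> F"
    and flip_unique:
      "I \<in> F \<Longrightarrow> i \<in> I \<Longrightarrow> j \<notin> I \<Longrightarrow> k \<notin> I \<Longrightarrow> i \<prec> j \<Longrightarrow> i \<prec> k \<Longrightarrow>
        insert j (I - {i}) \<in> F \<Longrightarrow> insert k (I - {i}) \<in> F \<Longrightarrow> j = k"
begin

definition agree :: "'p \<Rightarrow> 'p set \<Rightarrow> 'p set \<Rightarrow> bool" where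
  "agree p I J \<longleftrightarrow> (\<forall>q. q \<prec> p \<longrightarrow> (q \<in> I \<longleftrightarrow> q \<in> J))"

definition lex_less :: "'p set \<Rightarrow> 'p set \<Rightarrow> bool" where
  "lex_less I J \<longleftrightarrow> (\<exists>p. p \<in> I \<and> p \<notin> J \<and> agree p I J)"

definition flip :: "'p set \<Rightarrow> 'p set \<Rightarrow> bool" where
  "flip I J \<longleftrightarrow> I \<in> F \<and> J \<in> F \<and> (\<exists>i\<in>I. \<exists>j\<in>J. I - {i} = J - {j} \<and> i \<prec> j)"

text \<open>Meaningful on flips, where the difference is a singleton. It becomes
  \<open>p_label\<close> for the order \<open><\<close> and, on reversed arcs,
  \<open>n_label\<close> for the order \<open>>\<close>.\<close>

definition flipped :: "'p set \<times> 'p set \<Rightarrow> 'p" where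
  "flipped e = the_elem (fst e - snd e)"

definition sink :: "'p set \<Rightarrow> bool" where
  "sink N \<longleftrightarrow> N \<in> F \<and> (\<forall>J. \<not> flip N J)"

fun walk :: "'p set \<Rightarrow> ('p set \<times> 'p set) list \<Rightarrow> 'p set \<Rightarrow> bool" where
  "walk I [] J \<longleftrightarrow> I = J \<and> I \<in> F"
| "walk I (e # es) J \<longleftrightarrow> fst e = I \<and> flip I (snd e) \<and> walk (snd e) es J"

definition rising :: "'p set \<Rightarrow> ('p set \<times> 'p set) list \<Rightarrow> 'p set \<Rightarrow> bool" where
  "rising I es J \<longleftrightarrow> walk I es J \<and> sorted_wrt (\<prec>) (map flipped es)"

section \<open>Lexicographic comparison and single flips\<close>

lemma lt_asym: "x \<prec> y \<Longrightarrow> \<not> y \<prec> x"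
  using lt_irrefl lt_trans by blast

lemma agree_sym: "agree p I J \<Longrightarrow> agree p J I"
  by (auto simp: agree_def)

lemma agree_mono: "agree p I J \<Longrightarrow> q \<prec> p \<Longrightarrow> agree q I J"
  unfolding agree_def by (blast intro: lt_trans)

lemma agree_trans: "agree p I J \<Longrightarrow> agree p J K \<Longrightarrow> agree p I K"
  by (auto simp: agree_def)

lemma agreeD: "agree p I J \<Longrightarrow> q \<prec> p \<Longrightarrow> q \<in> I \<longleftrightarrow> q \<in> J"
  by (auto simp: agree_def)

lemma ex_first:
  assumes "finite A" "A \<noteq> {}"
  obtains p where "p \<in> A" "\<And>q. q \<in> A \<Longrightarrow> \<not> q \<prec> p"
proof -
  have "asymp_on A (\<prec>)"
    by (rule asymp_onI) (rule lt_asym)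
  moreover have "transp_on A (\<prec>)"
    by (rule transp_onI) (rule lt_trans)
  ultimately obtain p where "p \<in> A" "\<forall>q\<in>A. q \<noteq> p \<longrightarrow> \<not> q \<prec> p"
    using Finite_Set.bex_min_element[OF assms(1) _ _ assms(2)] by blast
  then show thesis
    using that lt_irrefl by metis
qed

lemma first_difference:
  assumes "I \<in> F" "J \<in> F" "I \<noteq> J"
  obtains p where "p \<in> I - J \<or> p \<in> J - I" "agree p I J"
proof -
  let ?D = "(I - J) \<union> (J - I)"
  have "finite ?D" "?D \<noteq> {}"
    using assms finite_member by auto
  then obtain p where p: "p \<in> ?D" "\<And>q. q \<in> ?D \<Longrightarrow> \<not> q \<prec> p"
    by (rule ex_first) blast
  have "agree p I J"
    using p(2) unfolding agree_def by blast
  then show thesis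
    using p(1) that by blast
qed

lemma lex_less_irrefl: "\<not> lex_less I I"
  by (auto simp: lex_less_def)

text \<open>The earlier of the two first differences is the first difference of \<open>I\<close> and
  \<open>K\<close>.\<close>

lemma lex_less_trans:
  assumes "lex_less I J" "lex_less J K"
  shows "lex_less I K"
proof -
  obtain p q where p: "p \<in> I" "p \<notin> J" "agree p I J" and q: "q \<in> J" "q \<notin> K" "agree q J K"
    using assms by (auto simp: lex_less_def)
  have "p \<noteq> q"
    using p q by auto
  then consider "p \<prec> q" | "q \<prec> p"
    using lt_total by blast
  then show ?thesis
  proof cases
    case 1
    then have "p \<notin> K" "agree p I K"
      using p q agreeD[OF q(3)] agree_trans agree_mono[OF q(3)] by blast+
    then show ?thesis
      using p by (auto simp: lex_less_def)
  next
    case 2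
    then have "q \<in> I" "agree q I K"
      using p q agreeD[OF p(3)] agree_trans agree_mono[OF p(3)] by blast+
    then show ?thesis
      using q by (auto simp: lex_less_def)
  qed
qed

lemma flipE:
  assumes "flip I J"
  obtains i j where "i \<in> I" "i \<notin> J" "j \<in> J" "j \<notin> I" "i \<prec> j" "J = insert j (I - {i})"
    "flipped (I, J) = i" "I \<in> F" "J \<in> F"
proof -
  obtain i j where *: "i \<in> I" "j \<in> J" "I - {i} = J - {j}" "i \<prec> j" "I \<in> F" "J \<in> F"
    using assms by (auto simp: flip_def)
  then have "i \<noteq> j"
    using lt_irrefl by auto
  then have 1: "i \<notin> J" "j \<notin> I"
    using * by blast+
  then have "I - J = {i}"
    using * by blast
  then have 2: "flipped (I, J) = i"
    by (simp add: flipped_def)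
  have 3: "J = insert j (I - {i})"
    using * by blast
  show thesis
    by (rule that[OF *(1) 1(1) *(2) 1(2) *(4) 3 2 *(5,6)])
qed

lemma flipI:
  assumes "I \<in> F" "insert j (I - {i}) \<in> F" "i \<in> I" "j \<notin> I" "i \<prec> j"
  shows "flip I (insert j (I - {i}))"
proof -
  have "I - {i} = insert j (I - {i}) - {j}"
    using assms by blast
  then show ?thesis
    unfolding flip_def using assms by blast
qed

text \<open>The new element comes after the removed one, so the removed one is the first difference.
  This makes flips acyclic, which yields a sink and a termination measure.\<close>

lemma flip_lex_less:
  assumes "flip I J"
  shows "lex_less I J"
  using assms
proof (rule flipE)
  fix i j assume *: "i \<in> I" "i \<notin> J" "i \<prec> j" "J = insert j (I - {i})"
  then have "agree i I J"
    using lt_asym lt_irrefl by (auto simp: agree_def)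
  then show ?thesis
    using * by (auto simp: lex_less_def)
qed

text \<open>The locale assumption in terms of \<open>flip\<close>. The new element comes after
  \<open>p\<close>, so everything before \<open>p\<close> survives, which keeps the agreement with
  \<open>J\<close> alive.\<close>

lemma flip_at:
  assumes "I \<in> F" "J \<in> F" "p \<in> I" "p \<notin> J" "agree p I J"
  obtains K where "flip I K" "flipped (I, K) = p" "p \<notin> K" "agree p I K"
proof -
  obtain j where j: "p \<prec> j" "j \<notin> I" "insert j (I - {p}) \<in> F"
    using flip_at_first_difference[OF assms(1-4)] assms(5) by (auto simp: agree_def)
  let ?K = "insert j (I - {p})"
  have "flip I ?K"
    using flipI assms j by auto
  moreover have "I - ?K = {p}"
    using assms j by auto
  then have "flipped (I, ?K) = p"
    by (simp add: flipped_def)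
  moreover have "p \<notin> ?K"
    using j lt_irrefl by auto
  moreover have "agree p I ?K"
    using j lt_asym lt_irrefl by (auto simp: agree_def)
  ultimately show thesis
    using that by blast
qed

lemma flip_eq:
  assumes "flip I J" "flip I K" "flipped (I, J) = flipped (I, K)"
  shows "J = K"
  using assms(1)
proof (rule flipE)
  fix i j assume 1: "i \<in> I" "i \<notin> J" "j \<in> J" "j \<notin> I" "i \<prec> j" "J = insert j (I - {i})"
    "flipped (I, J) = i" "I \<in> F" "J \<in> F"
  from assms(2) show ?thesis
  proof (rule flipE)
    fix i' k assume 2: "i' \<in> I" "k \<in> K" "k \<notin> I" "i' \<prec> k" "K = insert k (I - {i'})"
      "flipped (I, K) = i'" "K \<in> F"
    have "i' = i"
      using assms(3) 1 2 by simp
    then have "j = k"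
      using flip_unique[of I i j k] 1 2 by auto
    then show ?thesis
      using 1 2 \<open>i' = i\<close> by simp
  qed
qed

section \<open>The unique sink\<close>

text \<open>A lexicographically maximal member of the finite family has no flip, since flips
  ascend.\<close>

lemma ex_sink:
  assumes "F \<noteq> {}"
  shows "\<exists>N. sink N"
proof -
  have tr: "transp_on F lex_less"
    by (rule transp_onI) (rule lex_less_trans)
  have as: "asymp_on F lex_less"
    by (rule asymp_onI) (metis lex_less_irrefl lex_less_trans)
  obtain N where N: "N \<in> F" "\<forall>J\<in>F. J \<noteq> N \<longrightarrow> \<not> lex_less N J"
    using Finite_Set.bex_max_element[OF finite_family as tr assms] by (rule bexE)
  have "\<not> flip N J" for J
  proof
    assume "flip N J"
    then have "J \<in> F" "lex_less N J"
      by (simp_all add: flip_def flip_lex_less)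
    then show False
      using N(2) lex_less_irrefl by metis
  qed
  then have "sink N"
    using N(1) by (simp add: sink_def)
  then show ?thesis
    by blast
qed

text \<open>If the first difference lay in \<open>N\<close>, then \<open>flip_at\<close> would
  provide a flip of \<open>N\<close>.\<close>

lemma sink_first_difference:
  assumes "sink N" "I \<in> F" "I \<noteq> N"
  obtains p where "p \<in> I" "p \<notin> N" "agree p I N"
proof -
  have N: "N \<in> F" "\<And>J. \<not> flip N J"
    using assms by (auto simp: sink_def)
  obtain p where p: "p \<in> I - N \<or> p \<in> N - I" "agree p I N"
    using first_difference[OF assms(2) N(1) assms(3)] by blast
  have "p \<notin> N - I"
  proof
    assume "p \<in> N - I"
    then obtain K where "flip N K"
      using flip_at[OF N(1) assms(2) _ _ agree_sym[OF p(2)]] by blast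
    then show False
      using N(2) by simp
  qed
  then show thesis
    using p that by blast
qed

lemma sink_unique: "sink M \<Longrightarrow> sink N \<Longrightarrow> M = N"
proof (rule ccontr)
  assume "sink M" "sink N" "M \<noteq> N"
  moreover from this have MN: "M \<in> F" "N \<in> F" "\<And>J. \<not> flip M J"
    by (simp_all add: sink_def)
  ultimately obtain p where p: "p \<in> M" "p \<notin> N" "agree p M N"
    using sink_first_difference[of N M] by blast
  show False
    by (rule flip_at[OF MN(1,2) p]) (use MN(3) in simp)
qed

text \<open>A flip of \<open>I\<close> at some \<open>i\<close> before \<open>p\<close> gives a
  \<open>J\<close> that agrees with \<open>N\<close> before \<open>i\<close> and lacks
  \<open>i\<close>, while \<open>i\<close> is in \<open>N\<close>. Then \<open>flip_at\<close>,
  applied to \<open>N\<close> and \<open>J\<close>, would flip \<open>N\<close>.\<close>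

lemma flipped_not_before:
  assumes "sink N" "agree p I N" "flip I J"
  shows "\<not> flipped (I, J) \<prec> p"
proof
  assume less: "flipped (I, J) \<prec> p"
  from assms(3) show False
  proof (rule flipE)
    fix i j assume *: "i \<in> I" "i \<notin> J" "j \<in> J" "i \<prec> j" "J = insert j (I - {i})"
      "flipped (I, J) = i" "J \<in> F"
    have "i \<in> N"
      using * less assms(2) by (simp add: agree_def)
    moreover have "agree i I J"
      using * lt_asym lt_irrefl by (auto simp: agree_def)
    then have "agree i N J"
      using agree_trans[OF agree_sym[OF agree_mono[OF assms(2)]]] less * by simp
    ultimately obtain K where "flip N K"
      using flip_at[of N J i] * assms(1) by (auto simp: sink_def)
    then show False
      using assms(1) by (simp add: sink_def)
  qed
qed

section \<open>Rising walks to the sink\<close>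

text \<open>A flip alters only its label and one element after it, so an element before all labels
  is untouched.\<close>

lemma walk_keeps:
  assumes "walk I es J" "\<forall>e\<in>set es. x \<prec> flipped e" "K \<in> set (map snd es)"
  shows "x \<in> K \<longleftrightarrow> x \<in> I"
  using assms
proof (induction es arbitrary: I)
  case (Cons e es)
  from Cons.prems have e: "(I, snd e) = e" "flip I (snd e)" "x \<prec> flipped e"
    by (auto simp: prod_eq_iff)
  from e(2) have "x \<in> snd e \<longleftrightarrow> x \<in> I"
  proof (rule flipE)
    fix i j assume "i \<prec> j" "snd e = insert j (I - {i})" "flipped (I, snd e) = i"
    then show ?thesis
      using e(1,3) lt_irrefl lt_trans by (metis Diff_iff insert_iff singletonD)
  qed
  then show ?case
    using Cons by auto
qed simp

lemma walk_end: "walk I es J \<Longrightarrow> J \<in> set (I # map snd es)"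
  by (induction es arbitrary: I) auto

text \<open>The first label is removed from \<open>I\<close> and, preceding all later labels, never
  returns. Hence the distinctness of vertices demanded by \<open>apath\<close> is automatic for
  rising walks.\<close>

lemma rising_distinct:
  assumes "rising I es J"
  shows "distinct (I # map snd es)"
  using assms
proof (induction es arbitrary: I)
  case (Cons e es)
  then have e: "(I, snd e) = e" "flip I (snd e)" and es: "rising (snd e) es J"
    by (auto simp: rising_def prod_eq_iff)
  from e(2) have "I \<notin> set (map snd (e # es))"
  proof (rule flipE)
    fix i assume i: "i \<in> I" "i \<notin> snd e" "flipped (I, snd e) = i"
    have "\<forall>e'\<in>set es. i \<prec> flipped e'"
      using Cons.prems e(1) i by (auto simp: rising_def)
    then have "i \<notin> K" if "K \<in> set (map snd es)" for K
      using walk_keeps[of "snd e" es J i K] es that i by (auto simp: rising_def)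
    then show ?thesis
      using i by auto
  qed
  then show ?case
    using Cons.IH[OF es] by simp
qed simp

text \<open>Positions before the current label are never touched again, so a rising walk that skips the
  first position of \<open>I - N\<close> cannot end at \<open>N\<close>.\<close>

lemma rising_first_label:
  assumes "sink N" "p \<in> I" "p \<notin> N" "agree p I N" "rising I es N"
  obtains J es' where "es = (I, J) # es'" "flip I J" "flipped (I, J) = p" "rising J es' N"
proof -
  have "I \<noteq> N"
    using assms by auto
  then obtain e es' where es: "es = e # es'"
    using assms(5) by (cases es) (auto simp: rising_def)
  define J where "J = snd e"
  have e: "e = (I, J)" and J: "flip I J" "rising J es' N"
    and later: "\<forall>e'\<in>set es'. flipped e \<prec> flipped e'"
    using assms(5) es by (auto simp: rising_def J_def prod_eq_iff)
  have "\<not> p \<prec> flipped e"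
  proof
    assume less: "p \<prec> flipped e"
    then have "\<forall>e'\<in>set es. p \<prec> flipped e'"
      using es later lt_trans by auto
    then have "p \<in> N"
      using walk_keeps[of I es N p N] walk_end[of I es N] assms by (auto simp: rising_def)
    then show False
      using assms by simp
  qed
  then have "flipped (I, J) = p"
    using flipped_not_before[OF assms(1,4) J(1)] e lt_total by blast
  then show thesis
    using that es e J by blast
qed

text \<open>At each step the label is forced to be the first difference from \<open>N\<close>, and
  by \<open>flip_eq\<close> the label determines the next set.\<close>

lemma rising_unique:
  assumes "sink N" "rising I es N" "rising I fs N"
  shows "es = fs"
  using assms(2,3)
proof (induction es arbitrary: I fs)
  case Nil
  then show ?case
    using assms(1) by (cases fs) (auto simp: rising_def sink_def)
next
  case (Cons e es)
  then have "flip I (snd e)"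
    by (auto simp: rising_def)
  then have "I \<in> F" "I \<noteq> N"
    using assms(1) by (auto simp: flip_def sink_def)
  then obtain p where p: "p \<in> I" "p \<notin> N" "agree p I N"
    using sink_first_difference assms(1) by blast
  obtain J where J: "e = (I, J)" "flip I J" "flipped (I, J) = p" "rising J es N"
    using rising_first_label[OF assms(1) p Cons.prems(1)] by blast
  obtain K fs' where K: "fs = (I, K) # fs'" "flip I K" "flipped (I, K) = p" "rising K fs' N"
    using rising_first_label[OF assms(1) p Cons.prems(2)] by blast
  have "J = K"
    using flip_eq J K by simp
  then show ?case
    using J K Cons.IH by simp
qed

text \<open>The second conjunct strengthens the induction: labels come after every stretch on which
  \<open>I\<close> and \<open>N\<close> already agree, so a further flip can be put in front without
  breaking the rise.\<close>

lemma ex_rising_after: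
  assumes "sink N" "I \<in> F"
  shows "\<exists>es. rising I es N \<and>
    (\<forall>e\<in>set es. \<forall>q. agree q I N \<and> (q \<in> I \<longleftrightarrow> q \<in> N) \<longrightarrow> q \<prec> flipped e)"
  using assms(2)
\<comment> \<open>Each flip ascends lexicographically, so the number of members above the current
  one drops.\<close>
proof (induction "card {K \<in> F. lex_less I K}" arbitrary: I rule: less_induct)
  case less
  show ?case
  proof (cases "I = N")
    case True
    then show ?thesis
      using less.prems by (intro exI[of _ "[]"]) (simp add: rising_def)
  next
    case False
    have "N \<in> F"
      using assms(1) by (simp add: sink_def)
    from False obtain p where p: "p \<in> I" "p \<notin> N" "agree p I N"
      using sink_first_difference assms(1) less.prems by blast
    obtain J where J: "flip I J" "flipped (I, J) = p" "p \<notin> J" "agree p I J"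
      using flip_at[OF less.prems \<open>N \<in> F\<close> p] by blast
    have "J \<in> F"
      using J by (simp add: flip_def)
    have "{K \<in> F. lex_less J K} \<subset> {K \<in> F. lex_less I K}"
      using flip_lex_less[OF J(1)] lex_less_trans lex_less_irrefl \<open>J \<in> F\<close> by blast
    then have "card {K \<in> F. lex_less J K} < card {K \<in> F. lex_less I K}"
      using finite_family by (simp add: psubset_card_mono)
    from less.hyps[OF this \<open>J \<in> F\<close>] obtain es where es: "rising J es N"
      "\<forall>e\<in>set es. \<forall>q. agree q J N \<and> (q \<in> J \<longleftrightarrow> q \<in> N) \<longrightarrow> q \<prec> flipped e"
      by blast
    \<comment> \<open>Now \<open>J\<close> and \<open>N\<close> agree up to and including
      \<open>p\<close>, so the strengthened hypothesis at \<open>q = p\<close> puts all labels of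
      \<open>es\<close> after \<open>p\<close>.\<close>
    have "agree p J N"
      using J p agree_sym agree_trans by blast
    then have later: "\<forall>e\<in>set es. p \<prec> flipped e"
      using es(2) J(3) p(2) by blast
    have "rising I ((I, J) # es) N"
      using es(1) J later by (auto simp: rising_def)
    moreover have "q \<prec> flipped e"
      if "e \<in> set ((I, J) # es)" "agree q I N" "q \<in> I \<longleftrightarrow> q \<in> N" for e q
    proof -
      \<comment> \<open>The sets \<open>I\<close> and \<open>N\<close> differ at \<open>p\<close>,
        so a stretch of agreement ending with \<open>q\<close> stops before
        \<open>p\<close>.\<close>
      have "\<not> p \<prec> q" "q \<noteq> p"
        using agreeD[OF that(2), of p] that(3) p by blast+
      then have "q \<prec> p"
        using lt_total by blast
      moreover have "flipped e = p \<or> p \<prec> flipped e"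
        using that(1) J(2) later by auto
      ultimately show ?thesis
        by (metis lt_trans)
    qed
    ultimately show ?thesis
      by blast
  qed
qed

lemma ex1_rising:
  assumes "sink N" "I \<in> F"
  shows "\<exists>!es. rising I es N"
  using ex_rising_after[OF assms] rising_unique[OF assms(1)] by blast

text \<open>The uniqueness clause serves to evaluate the description operator in
  \<open>rising_path\<close>; the other clauses describe the first arc, which determines the
  father.\<close>

theorem first_step_of_rising:
  assumes "sink N" "I \<in> F" "I \<noteq> N"
  obtains es p where "rising I es N" "\<And>fs. rising I fs N \<Longrightarrow> fs = es" "es \<noteq> []"
    "flip I (snd (hd es))" "flipped (I, snd (hd es)) = p"
    "p \<in> I - N" "\<And>q. q \<in> I - N \<Longrightarrow> \<not> q \<prec> p"
proof -
  obtain es where es: "rising I es N" "\<And>fs. rising I fs N \<Longrightarrow> fs = es"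
    using ex1_rising[OF assms(1,2)] by blast
  obtain p where p: "p \<in> I" "p \<notin> N" "agree p I N"
    using sink_first_difference[OF assms] by blast
  show thesis
    using rising_first_label[OF assms(1) p es(1)]
  proof cases
    case (1 J es')
    then show thesis
      using that[OF es] p agreeD[OF p(3)] by auto
  qed
qed

end

section \<open>Words in Coxeter systems\<close>

context group
begin

lemma word_prod_Nil [simp]: "word_prod G [] = \<one>"
  by (simp add: word_prod_def)

lemma word_prod_Cons [simp]: "word_prod G (s # w) = s \<otimes> word_prod G w"
  by (simp add: word_prod_def)

lemma word_prod_closed [simp]: "set w \<subseteq> carrier G \<Longrightarrow> word_prod G w \<in> carrier G"
  by (induction w) auto

lemma word_prod_append [simp]:
  "set u \<subseteq> carrier G \<Longrightarrow> set v \<subseteq> carrier G \<Longrightarrow>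
    word_prod G (u @ v) = word_prod G u \<otimes> word_prod G v"
  by (induction u) (auto simp: m_assoc)

end

locale coxeter = group W for W (structure) +
  fixes S
  assumes coxeter_system: "coxeter_system W S"
begin

abbreviation wp :: "'a list \<Rightarrow> 'a" where
  "wp \<equiv> word_prod W"

lemma S_subset: "S \<subseteq> carrier W"
  using coxeter_system by (simp add: coxeter_system_def)

lemma S_closed [simp]: "s \<in> S \<Longrightarrow> s \<in> carrier W"
  using S_subset by blast

lemma word_in_carrier [simp]: "w \<in> lists S \<Longrightarrow> set w \<subseteq> carrier W"
  using S_subset by auto

text \<open>The diagonal entry \<open>M s s = 1\<close> turns the defining relation for the pair
  \<open>s\<close>, \<open>s\<close> into the word \<open>[s, s]\<close>.\<close>

lemma square [simp]: "s \<in> S \<Longrightarrow> s \<otimes> s = \<one>"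
proof -
  assume s: "s \<in> S"
  obtain M where M: "coxeter_matrix S M"
    "\<And>u v. u \<in> lists S \<Longrightarrow> v \<in> lists S \<Longrightarrow> wp u = wp v \<longleftrightarrow> coxeter_equiv S M u v"
    using coxeter_system by (auto simp: coxeter_system_def)
  have "M s s = 1"
    using M(1) s by (simp add: coxeter_matrix_def)
  then have "coxeter_equiv S M [s, s] []"
    using coxeter_equiv.relation[of "[]" S "[]" s s M] s by simp
  then show ?thesis
    using M(2)[of "[s, s]" "[]"] s by simp
qed

lemma inv_generator [simp]: "s \<in> S \<Longrightarrow> inv s = s"
  by (simp add: inv_equality)

lemma cancel_square [simp]: "s \<in> S \<Longrightarrow> x \<in> carrier W \<Longrightarrow> s \<otimes> (s \<otimes> x) = x"
  by (simp add: m_assoc[symmetric])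

lemma wp_rev: "w \<in> lists S \<Longrightarrow> wp (rev w) = inv (wp w)"
  by (induction w) (auto simp: inv_mult_group)

section \<open>Counting reflections along a word\<close>

text \<open>The number of indices \<open>k\<close> with \<open>w\<^sub>1 \<cdots> w\<^sub>k\<^sub>-\<^sub>1 w\<^sub>k w\<^sub>k\<^sub>-\<^sub>1 \<cdots> w\<^sub>1 = x\<close>.\<close>

fun refl_count :: "'a list \<Rightarrow> 'a \<Rightarrow> nat" where
  "refl_count [] x = 0"
| "refl_count (s # w) x = of_bool (x = s) + refl_count w (s \<otimes> x \<otimes> s)"

text \<open>Each letter passed conjugates the reflection under test, so after \<open>u\<close> the
  test continues with the conjugate by \<open>wp u\<close>.\<close>

lemma refl_count_append:
  assumes "u \<in> lists S" "v \<in> lists S" "x \<in> carrier W"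
  shows "refl_count (u @ v) x = refl_count u x + refl_count v (inv (wp u) \<otimes> x \<otimes> wp u)"
  using assms
proof (induction u arbitrary: x)
  case (Cons s u)
  then show ?case
    by (auto simp: inv_mult_group m_assoc)
qed simp

text \<open>Counting from 0, the reflection at index \<open>i\<close> of the word s t s t ... is
  \<open>(s \<otimes> t) [^] i \<otimes> s\<close>.\<close>

lemma refl_count_alternating:
  assumes "s \<in> S" "t \<in> S" "x \<in> carrier W"
  shows "refl_count (concat (replicate k [s, t])) x =
    (\<Sum>i<2 * k. of_bool (x = (s \<otimes> t) [^] i \<otimes> s))"
  using assms(3)
proof (induction k arbitrary: x)
  case (Suc k)
  \<comment> \<open>Passing the first two letters undoes a conjugation by
    \<open>s \<otimes> t\<close>, which shifts the exponent by two.\<close>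
  have shift: "t \<otimes> (s \<otimes> x \<otimes> s) \<otimes> t = (s \<otimes> t) [^] i \<otimes> s \<longleftrightarrow> x = (s \<otimes> t) [^] Suc (Suc i) \<otimes> s"
    for i :: nat
  proof -
    have *: "(s \<otimes> t) [^] Suc (Suc i) \<otimes> s = s \<otimes> t \<otimes> ((s \<otimes> t) [^] i \<otimes> s) \<otimes> t \<otimes> s"
    proof -
      have "(s \<otimes> t) [^] Suc (Suc i) = s \<otimes> t \<otimes> (s \<otimes> t) [^] i \<otimes> (s \<otimes> t)"
        using assms nat_pow_Suc2[of "s \<otimes> t"] by simp
      then show ?thesis
        using assms by (simp add: m_assoc)
    qed
    have "x = s \<otimes> t \<otimes> (t \<otimes> (s \<otimes> x \<otimes> s) \<otimes> t) \<otimes> t \<otimes> s"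
      using assms Suc.prems by (simp add: m_assoc)
    moreover have "t \<otimes> (s \<otimes> (s \<otimes> t \<otimes> y \<otimes> t \<otimes> s) \<otimes> s) \<otimes> t = y" if "y \<in> carrier W" for y
      using assms that by (simp add: m_assoc)
    ultimately show ?thesis
      using * assms by (metis S_closed m_closed nat_pow_closed)
  qed
  have s2: "s \<otimes> x \<otimes> s = t \<longleftrightarrow> x = (s \<otimes> t) [^] Suc 0 \<otimes> s"
    using assms Suc.prems by (auto simp: m_assoc)
  have "refl_count (concat (replicate (Suc k) [s, t])) x =
      of_bool (x = s) + (of_bool (s \<otimes> x \<otimes> s = t)
        + refl_count (concat (replicate k [s, t])) (t \<otimes> (s \<otimes> x \<otimes> s) \<otimes> t))"
    by simp
  also have "\<dots> = of_bool (x = (s \<otimes> t) [^] (0::nat) \<otimes> s) + (of_bool (x = (s \<otimes> t) [^] Suc 0 \<otimes> s)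
        + (\<Sum>i<2 * k. of_bool (x = (s \<otimes> t) [^] Suc (Suc i) \<otimes> s)))"
    using assms Suc s2 by (simp add: shift del: nat_pow_Suc)
  also have "\<dots> = (\<Sum>i<Suc (Suc (2 * k)). of_bool (x = (s \<otimes> t) [^] i \<otimes> s))"
    by (simp only: sum.lessThan_Suc_shift)
  finally show ?case
    by simp
qed simp

lemma wp_alternating:
  "s \<in> S \<Longrightarrow> t \<in> S \<Longrightarrow> wp (concat (replicate k [s, t])) = (s \<otimes> t) [^] k"
proof (induction k)
  case (Suc k)
  have "set (concat (replicate k [s, t])) \<subseteq> carrier W"
    using Suc.prems by (auto simp: set_replicate_conv_if)
  then show ?case
    using Suc nat_pow_Suc2[of "s \<otimes> t" k] by (simp add: m_assoc)
qed simp

text \<open>The \<open>2 * k\<close> reflections of the relator repeat with period \<open>k\<close>,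
  so each is counted an even number of times.\<close>

lemma even_refl_count_relation:
  assumes "s \<in> S" "t \<in> S" "x \<in> carrier W" "(s \<otimes> t) [^] k = \<one>"
  shows "even (refl_count (concat (replicate k [s, t])) x)"
proof -
  let ?f = "\<lambda>i. of_bool (x = (s \<otimes> t) [^] i \<otimes> s) :: nat"
  have "?f (k + i) = ?f i" for i
    using assms nat_pow_mult[of "s \<otimes> t" k i, symmetric] by simp
  then have "(\<Sum>i<k + n. ?f i) = (\<Sum>i<k. ?f i) + (\<Sum>i<n. ?f i)" for n
    by (induction n) (simp_all del: nat_pow_Suc)
  from this[of k] have "(\<Sum>i<2 * k. ?f i) = 2 * (\<Sum>i<k. ?f i)"
    by (simp add: mult_2)
  then show ?thesis
    using refl_count_alternating[OF assms(1-3)] by simp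
qed

text \<open>The parity of the number of occurrences of a reflection is an invariant of the group element;
  for reduced words it is the indicator function of the inversion set.\<close>

lemma refl_count_parity:
  assumes "u \<in> lists S" "v \<in> lists S" "wp u = wp v" "x \<in> carrier W"
  shows "even (refl_count u x) \<longleftrightarrow> even (refl_count v x)"
proof -
  obtain M where M: "\<And>u v. u \<in> lists S \<Longrightarrow> v \<in> lists S \<Longrightarrow> wp u = wp v \<longleftrightarrow> coxeter_equiv S M u v"
    using coxeter_system by (auto simp: coxeter_system_def)
  have "coxeter_equiv S M u v"
    using M assms by blast
  then show ?thesis
    using assms(4)
  proof (induction arbitrary: x rule: coxeter_equiv.induct)
    case (relation u v s t)
    let ?r = "concat (replicate (M s t) [s, t])"
    let ?y = "inv (wp u) \<otimes> x \<otimes> wp u"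
    have r: "?r \<in> lists S"
      using relation by (auto simp: set_replicate_conv_if)
    have "coxeter_equiv S M ?r []"
      using coxeter_equiv.relation[of "[]" S "[]" s t M] relation by simp
    then have one: "wp ?r = \<one>"
      using M[OF r, of "[]"] by simp
    \<comment> \<open>The relator contributes an even amount, and since its value is the identity,
      the reflection tested along \<open>v\<close> is the same with or without it.\<close>
    then have "even (refl_count ?r ?y)"
      using relation wp_alternating[of s t] by (intro even_refl_count_relation) auto
    then show ?case
      using relation r one by (simp add: refl_count_append)
  qed auto
qed

lemma refl_count_posE:
  assumes "refl_count w x > 0" "w \<in> lists S" "x \<in> carrier W"
  obtains a j b where "w = a @ j # b" "x \<otimes> wp a = wp a \<otimes> j"
  using assms
proof (induction w arbitrary: x thesis)
  case (Cons s w)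
  show ?case
  proof (cases "x = s")
    case True
    then show ?thesis
      using Cons.prems(1)[of "[]" s w] Cons.prems by simp
  next
    case False
    then obtain a j b where *: "w = a @ j # b" "s \<otimes> x \<otimes> s \<otimes> wp a = wp a \<otimes> j"
      using Cons.IH[of "s \<otimes> x \<otimes> s"] Cons.prems by auto
    have "x \<otimes> (s \<otimes> wp a) = s \<otimes> (s \<otimes> x \<otimes> s \<otimes> wp a)"
      using Cons.prems *(1) by (simp add: m_assoc)
    also have "\<dots> = s \<otimes> wp a \<otimes> j"
      using Cons.prems *(1) by (simp add: *(2)) (simp add: m_assoc)
    finally show ?thesis
      using Cons.prems(1)[of "s # a" j b] * by simp
  qed
qed simp

section \<open>Reduced words and the exchange condition\<close>

definition reduced :: "'a list \<Rightarrow> bool" where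
  "reduced w \<longleftrightarrow> w \<in> lists S \<and> (\<forall>v\<in>lists S. wp v = wp w \<longrightarrow> length w \<le> length v)"

lemma reduced_lists: "reduced w \<Longrightarrow> w \<in> lists S"
  by (simp add: reduced_def)

lemma reduced_length: "reduced w \<Longrightarrow> v \<in> lists S \<Longrightarrow> wp v = wp w \<Longrightarrow> length w \<le> length v"
  by (simp add: reduced_def)

text \<open>A shorter word for a factor could be substituted into the whole word.\<close>

lemma reduced_appendD:
  assumes "reduced (u @ v)"
  shows "reduced u" "reduced v"
proof -
  have uv: "u \<in> lists S" "v \<in> lists S"
    using reduced_lists[OF assms] by auto
  have "length u \<le> length u'" if "u' \<in> lists S" "wp u' = wp u" for u'
    using reduced_length[OF assms, of "u' @ v"] that uv by simp
  then show "reduced u"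
    using uv by (simp add: reduced_def)
  have "length v \<le> length v'" if "v' \<in> lists S" "wp v' = wp v" for v'
    using reduced_length[OF assms, of "u @ v'"] that uv by simp
  then show "reduced v"
    using uv by (simp add: reduced_def)
qed

lemma reduced_rev:
  assumes "reduced w"
  shows "reduced (rev w)"
proof -
  have w: "w \<in> lists S"
    using reduced_lists[OF assms] .
  have "length w \<le> length v" if "v \<in> lists S" "wp v = wp (rev w)" for v
  proof -
    have "rev v \<in> lists S" "wp (rev v) = wp w"
      using that w wp_rev[of v] wp_rev[of w] by auto
    then show ?thesis
      using reduced_length[OF assms] by fastforce
  qed
  then show ?thesis
    using w by (auto simp: reduced_def)
qed

text \<open>Equality would give s c t = c in the group, so dropping both letters would leave a
  shorter word with the same value.\<close>

lemma reduced_no_cancel: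
  assumes "reduced (a @ s # c @ t # d)"
  shows "s \<otimes> wp c \<noteq> wp c \<otimes> t"
proof
  assume eq: "s \<otimes> wp c = wp c \<otimes> t"
  have mem: "a \<in> lists S" "c \<in> lists S" "d \<in> lists S" "s \<in> S" "t \<in> S"
    using reduced_lists[OF assms] by auto
  have "wp (a @ s # c @ t # d) = wp a \<otimes> (s \<otimes> wp c \<otimes> t \<otimes> wp d)"
    using mem by (simp add: m_assoc)
  also have "\<dots> = wp (a @ c @ d)"
    using mem eq by (simp add: m_assoc)
  finally show False
    using reduced_length[OF assms, of "a @ c @ d"] mem by simp
qed

text \<open>The reflection \<open>s\<close> occurs exactly once in the reduced word
  \<open>s # b\<close>, since another occurrence would let two letters cancel. By parity it occurs
  in \<open>a\<close> too, and the letter found there can be traded for an \<open>s\<close> in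
  front.\<close>

lemma exchange_left:
  assumes "reduced a" "reduced (s # b)" "wp a = wp (s # b)"
  obtains a1 j a2 where "a = a1 @ j # a2" "wp (s # a1 @ a2) = wp a"
proof -
  have mem: "a \<in> lists S" "b \<in> lists S" "s \<in> S"
    using assms(1,2) by (auto simp: reduced_def)
  have "refl_count b s = 0"
  proof (rule ccontr)
    assume "refl_count b s \<noteq> 0"
    then obtain b1 j b2 where "b = b1 @ j # b2" "s \<otimes> wp b1 = wp b1 \<otimes> j"
      using refl_count_posE[of b s] mem by auto
    then show False
      using reduced_no_cancel[of "[]" s b1 j b2] assms(2) by simp
  qed
  \<comment> \<open>The recursion passes on to \<open>s \<otimes> s \<otimes> s\<close>, which is
    \<open>s\<close> again.\<close>
  then have "refl_count (s # b) s = 1"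
    using mem by simp
  then have "odd (refl_count a s)"
    using refl_count_parity[of a "s # b" s] assms(3) mem by simp
  then have "refl_count a s > 0"
    by (simp add: odd_pos)
  then obtain a1 j a2 where a: "a = a1 @ j # a2" "s \<otimes> wp a1 = wp a1 \<otimes> j"
    using refl_count_posE[of a s] mem by auto
  have "wp (s # a1 @ a2) = s \<otimes> wp a1 \<otimes> wp a2"
    using a(1) mem by (simp add: m_assoc)
  also have "\<dots> = wp a"
    using a(1) mem by (simp add: a(2)) (simp add: m_assoc)
  finally show thesis
    using that a by blast
qed

text \<open>This is \<open>exchange_left\<close> for the reversed words, which represent the
  inverse.\<close>

lemma exchange_right:
  assumes "reduced a" "reduced (b @ [s])" "wp a = wp (b @ [s])"
  obtains a1 j a2 where "a = a1 @ j # a2" "wp (a1 @ a2 @ [s]) = wp a"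
proof -
  have mem: "a \<in> lists S" "b \<in> lists S" "s \<in> S"
    using assms(1,2) by (auto simp: reduced_def)
  have "wp (rev a) = wp (s # rev b)"
    using assms(3) wp_rev[of a] wp_rev[of "b @ [s]"] mem by simp
  then obtain c1 j c2 where c: "rev a = c1 @ j # c2" "wp (s # c1 @ c2) = wp (rev a)"
    using exchange_left[of "rev a" s "rev b"] reduced_rev[OF assms(1)] reduced_rev[OF assms(2)]
    by auto
  have a: "a = rev c2 @ j # rev c1"
    using arg_cong[OF c(1), of rev] by simp
  have "s # c1 @ c2 \<in> lists S"
    using a mem by auto
  then have "wp (rev (s # c1 @ c2)) = inv (inv (wp a))"
    using c(2) wp_rev[of "s # c1 @ c2"] wp_rev[of a] mem by simp
  also have "\<dots> = wp a"
    using mem by simp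
  finally show thesis
    using that[OF a] by simp
qed

end

section \<open>Subword complexes\<close>

lemma subword_at_singleton: "subword_at Q {k} = [Q ! (k - 1)]"
  by (simp add: subword_at_def)

lemma length_subword_at: "finite A \<Longrightarrow> length (subword_at Q A) = card A"
  by (simp add: subword_at_def)

lemma sorted_list_of_set_Un:
  fixes A B :: "'b::linorder set"
  assumes "finite A" "finite B" "\<And>a b. a \<in> A \<Longrightarrow> b \<in> B \<Longrightarrow> a < b"
  shows "sorted_list_of_set (A \<union> B) = sorted_list_of_set A @ sorted_list_of_set B"
proof (rule strict_sorted_equal)
  show "sorted_wrt (<) (sorted_list_of_set A @ sorted_list_of_set B)"
    using assms by (auto simp: sorted_wrt_append)
qed (use assms in auto)

lemma subword_at_Un:
  "finite A \<Longrightarrow> finite B \<Longrightarrow> (\<And>a b. a \<in> A \<Longrightarrow> b \<in> B \<Longrightarrow> a < b) \<Longrightarrow>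
    subword_at Q (A \<union> B) = subword_at Q A @ subword_at Q B"
  by (simp add: subword_at_def sorted_list_of_set_Un)

lemma subword_at_split_notin:
  assumes "finite A" "p \<notin> A"
  shows "subword_at Q A = subword_at Q (A \<inter> {..<p}) @ subword_at Q (A \<inter> {p<..})"
proof -
  have "A = (A \<inter> {..<p}) \<union> (A \<inter> {p<..})"
    using assms(2) by (auto simp: not_less_iff_gr_or_eq)
  then show ?thesis
    using subword_at_Un[of "A \<inter> {..<p}" "A \<inter> {p<..}" Q] assms(1) by auto
qed

lemma subword_at_split:
  assumes "finite A" "p \<in> A"
  shows "subword_at Q A =
    subword_at Q (A \<inter> {..<p}) @ Q ! (p - 1) # subword_at Q (A \<inter> {p<..})"
proof -
  have "A = (A \<inter> {..<p}) \<union> ({p} \<union> (A \<inter> {p<..}))"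
    using assms(2) by (auto simp: not_less_iff_gr_or_eq)
  then have "subword_at Q A = subword_at Q ((A \<inter> {..<p}) \<union> ({p} \<union> (A \<inter> {p<..})))"
    by simp
  also have "\<dots> = subword_at Q (A \<inter> {..<p}) @ subword_at Q ({p} \<union> (A \<inter> {p<..}))"
    using assms(1) by (intro subword_at_Un) auto
  also have "subword_at Q ({p} \<union> (A \<inter> {p<..})) = subword_at Q {p} @ subword_at Q (A \<inter> {p<..})"
    using assms(1) by (intro subword_at_Un) auto
  finally show ?thesis
    by (simp add: subword_at_singleton)
qed

text \<open>Different positions may carry equal letters, so the split of the word is traced back to
  the list of positions, whose entries are distinct.\<close>

lemma subword_at_eq_appendE:
  assumes "finite A" "subword_at Q A = u @ s # v"
  obtains j where "j \<in> A" "subword_at Q (A - {j}) = u @ v"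
proof -
  obtain l1 j l2 where l: "sorted_list_of_set A = l1 @ j # l2"
    "u = map (\<lambda>k. Q ! (k - 1)) l1" "v = map (\<lambda>k. Q ! (k - 1)) l2"
    using assms(2) unfolding subword_at_def by (auto simp: map_eq_append_conv map_eq_Cons_conv)
  have "distinct (l1 @ j # l2)"
    using distinct_sorted_list_of_set[of A] l(1) by simp
  then have "sorted_list_of_set (A - {j}) = l1 @ l2"
    using sorted_list_of_set_remove[OF assms(1), of j] l(1) by (simp add: remove1_append)
  moreover have "j \<in> A"
    using assms(1) l(1) set_sorted_list_of_set[of A] by (metis in_set_conv_decomp)
  ultimately show thesis
    using that l by (simp add: subword_at_def)
qed

locale subword_complex = coxeter W S for W (structure) and S +
  fixes Q :: "'a list" and \<rho> :: 'a
  assumes Q: "Q \<in> lists S"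
begin

abbreviation positions :: "nat set" where
  "positions \<equiv> {1..length Q}"

abbreviation sub :: "nat set \<Rightarrow> 'a list" where
  "sub \<equiv> subword_at Q"

abbreviation facets :: "nat set set" where
  "facets \<equiv> subword_facets W S Q \<rho>"

lemma reduced_expression_iff: "reduced_expression W S x w \<longleftrightarrow> reduced w \<and> wp w = x"
proof -
  have "length w = coxeter_length W S x \<longleftrightarrow> (\<forall>v\<in>lists S. wp v = x \<longrightarrow> length w \<le> length v)"
    if "w \<in> lists S" "wp w = x"
  proof
    assume "length w = coxeter_length W S x"
    then show "\<forall>v\<in>lists S. wp v = x \<longrightarrow> length w \<le> length v"
      unfolding coxeter_length_def by (auto intro!: Least_le)
  next
    assume "\<forall>v\<in>lists S. wp v = x \<longrightarrow> length w \<le> length v"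
    then show "length w = coxeter_length W S x"
      unfolding coxeter_length_def using that by (intro Least_equality[symmetric]) auto
  qed
  then show ?thesis
    by (auto simp: reduced_expression_def reduced_def)
qed

lemma facet_iff:
  "I \<in> facets \<longleftrightarrow> I \<subseteq> positions \<and> reduced (sub (positions - I)) \<and> wp (sub (positions - I)) = \<rho>"
  by (auto simp: subword_facets_def reduced_expression_iff)

lemma nth_in_S: "k \<in> positions \<Longrightarrow> Q ! (k - 1) \<in> S"
  using Q by (auto dest: nth_mem)

lemma sub_in_lists:
  assumes "A \<subseteq> positions"
  shows "sub A \<in> lists S"
proof -
  have "finite A"
    using assms finite_subset by blast
  then have "set (sub A) = (\<lambda>k. Q ! (k - 1)) ` A"
    by (simp add: subword_at_def)
  also have "\<dots> \<subseteq> S"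
  proof (rule image_subsetI)
    fix k assume "k \<in> A"
    then show "Q ! (k - 1) \<in> S"
      by (rule nth_in_S[OF subsetD[OF assms]])
  qed
  finally show ?thesis
    unfolding lists_eq_set by simp
qed

section \<open>Flips of facets\<close>

text \<open>Trading one position for another keeps the length, so a word obtained in this way with
  value \<open>\<rho>\<close> is as short as the reduced word of \<open>I\<close>.\<close>

lemma facet_flipI:
  assumes "I \<in> facets" "i \<in> I" "j \<in> positions - I"
    "wp (sub (insert i (positions - I - {j}))) = \<rho>"
  shows "insert j (I - {i}) \<in> facets"
proof -
  let ?K = "positions - I"
  have I: "I \<subseteq> positions" "reduced (sub ?K)" "wp (sub ?K) = \<rho>"
    using assms(1) by (auto simp: facet_iff)
  have eq: "positions - insert j (I - {i}) = insert i (?K - {j})"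
    using assms(2,3) I(1) by blast
  have "card (insert i (?K - {j})) = Suc (card (?K - {j}))"
    using assms(2) by (intro card_insert_disjoint) auto
  also have "\<dots> = card ?K"
    using assms(3) by (intro card_Suc_Diff1) auto
  finally have "card (insert i (?K - {j})) = card ?K" .
  then have "length (sub (insert i (?K - {j}))) = length (sub ?K)"
    by (simp add: length_subword_at)
  moreover have "sub (insert i (?K - {j})) \<in> lists S"
    using assms(2) I(1) by (intro sub_in_lists) auto
  ultimately have "reduced (sub (insert i (?K - {j})))"
    using I(2,3) assms(4) by (simp add: reduced_def)
  moreover have "insert j (I - {i}) \<subseteq> positions"
    using assms(3) I(1) by blast
  ultimately show ?thesis
    unfolding facet_iff eq using assms(4) by blast
qed

text \<open>After the common prefix cancels, the rest of the word of \<open>J\<close> starts with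
  the letter at \<open>p\<close>. So \<open>exchange_left\<close> puts this letter in front of the
  rest of the word of \<open>I\<close> and deletes a letter further right.\<close>

lemma increasing_flip_at_first_difference:
  assumes "I \<in> facets" "J \<in> facets" "p \<in> I" "p \<notin> J" "\<And>q. q < p \<Longrightarrow> q \<in> I \<longleftrightarrow> q \<in> J"
  shows "\<exists>j>p. j \<notin> I \<and> insert j (I - {p}) \<in> facets"
proof -
  \<comment> \<open>Facets collect the omitted positions: the word of \<open>J\<close> reads
    \<open>p\<close>, that of \<open>I\<close> does not, and \<open>?B\<close> holds what both read
    before \<open>p\<close>.\<close>
  let ?K = "positions - I" and ?L = "positions - J" and ?s = "Q ! (p - 1)"
  let ?K' = "?K \<inter> {p<..}" and ?B = "?K \<inter> {..<p}"
  have I: "I \<subseteq> positions" "reduced (sub ?K)" "wp (sub ?K) = \<rho>"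
    and J: "reduced (sub ?L)" "wp (sub ?L) = \<rho>"
    using assms(1,2) by (auto simp: facet_iff)
  have B: "?L \<inter> {..<p} = ?B"
    using assms(5) by auto
  have p: "p \<in> positions" "?s \<in> S"
    using I(1) assms(3) nth_in_S[of p] by auto
  have K: "sub ?K = sub ?B @ sub ?K'"
    using assms(3) by (intro subword_at_split_notin) auto
  have L: "sub ?L = sub ?B @ ?s # sub (?L \<inter> {p<..})"
    using subword_at_split[of ?L p Q] assms(4) p B by simp
  have words: "sub ?B \<in> lists S" "sub ?K' \<in> lists S" "sub (?L \<inter> {p<..}) \<in> lists S"
    by (rule sub_in_lists, blast)+
  have red: "reduced (sub ?K')" "reduced (?s # sub (?L \<inter> {p<..}))"
    using I(2) J(1) reduced_appendD(2) unfolding K L by blast+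
  have "wp (sub ?B) \<otimes> wp (sub ?K') = wp (sub ?B) \<otimes> wp (?s # sub (?L \<inter> {p<..}))"
    using I(3) J(2) words p(2) unfolding K L by simp
  then have "wp (sub ?K') = wp (?s # sub (?L \<inter> {p<..}))"
    using words p(2) by (subst (asm) Units_l_cancel) auto
  from exchange_left[OF red this] obtain a1 x a2
    where a: "sub ?K' = a1 @ x # a2" "wp (?s # a1 @ a2) = wp (sub ?K')"
    by blast
  obtain j where j: "j \<in> ?K'" "sub (?K' - {j}) = a1 @ a2"
    using subword_at_eq_appendE[OF _ a(1)] by blast
  \<comment> \<open>This is the complement of \<open>insert j (I - {p})\<close>.\<close>
  let ?N = "insert p (?K - {j})"
  have "?N \<inter> {..<p} = ?B" "?N \<inter> {p<..} = ?K' - {j}"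
    using j(1) by auto
  then have N: "sub ?N = sub ?B @ ?s # a1 @ a2"
    using subword_at_split[of ?N p Q] j(2) by simp
  have "a1 @ a2 \<in> lists S"
    using words(2) a(1) by simp
  then have "wp (sub ?N) = wp (sub ?B) \<otimes> wp (?s # a1 @ a2)"
    using words p(2) unfolding N by (subst word_prod_append) auto
  also have "\<dots> = \<rho>"
    using a(2) I(3) words unfolding K by simp
  finally have "insert j (I - {p}) \<in> facets"
    using facet_flipI[OF assms(1,3), of j] j(1) by blast
  then show ?thesis
    using j(1) by auto
qed

text \<open>The mirror image: a common suffix cancels, and \<open>exchange_right\<close> appends the
  letter at \<open>p\<close>.\<close>

lemma decreasing_flip_at_last_difference:
  assumes "I \<in> facets" "J \<in> facets" "p \<in> I" "p \<notin> J" "\<And>q. q > p \<Longrightarrow> q \<in> I \<longleftrightarrow> q \<in> J"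
  shows "\<exists>j<p. j \<notin> I \<and> insert j (I - {p}) \<in> facets"
proof -
  let ?K = "positions - I" and ?L = "positions - J" and ?s = "Q ! (p - 1)"
  let ?K' = "?K \<inter> {..<p}" and ?B = "?K \<inter> {p<..}"
  have I: "I \<subseteq> positions" "reduced (sub ?K)" "wp (sub ?K) = \<rho>"
    and J: "reduced (sub ?L)" "wp (sub ?L) = \<rho>"
    using assms(1,2) by (auto simp: facet_iff)
  have B: "?L \<inter> {p<..} = ?B"
    using assms(5) by auto
  have p: "p \<in> positions" "?s \<in> S"
    using I(1) assms(3) nth_in_S[of p] by auto
  have K: "sub ?K = sub ?K' @ sub ?B"
    using assms(3) by (intro subword_at_split_notin) auto
  have L: "sub ?L = (sub (?L \<inter> {..<p}) @ [?s]) @ sub ?B"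
    using subword_at_split[of ?L p Q] assms(4) p B by simp
  have words: "sub ?B \<in> lists S" "sub ?K' \<in> lists S" "sub (?L \<inter> {..<p}) \<in> lists S"
    by (rule sub_in_lists, blast)+
  have red: "reduced (sub ?K')" "reduced (sub (?L \<inter> {..<p}) @ [?s])"
    using I(2) J(1) reduced_appendD(1) unfolding K L by blast+
  have "wp (sub ?K') \<otimes> wp (sub ?B) = wp (sub (?L \<inter> {..<p}) @ [?s]) \<otimes> wp (sub ?B)"
    using I(3) J(2) words p(2) unfolding K L by (simp add: m_assoc)
  then have "wp (sub ?K') = wp (sub (?L \<inter> {..<p}) @ [?s])"
    using words p(2) by (subst (asm) right_cancel) auto
  from exchange_right[OF red this] obtain a1 x a2
    where a: "sub ?K' = a1 @ x # a2" "wp (a1 @ a2 @ [?s]) = wp (sub ?K')"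
    by blast
  obtain j where j: "j \<in> ?K'" "sub (?K' - {j}) = a1 @ a2"
    using subword_at_eq_appendE[OF _ a(1)] by blast
  let ?N = "insert p (?K - {j})"
  have "?N \<inter> {p<..} = ?B" "?N \<inter> {..<p} = ?K' - {j}"
    using j(1) by auto
  then have N: "sub ?N = (a1 @ a2 @ [?s]) @ sub ?B"
    using subword_at_split[of ?N p Q] j(2) by simp
  have "a1 @ a2 @ [?s] \<in> lists S"
    using words(2) a(1) p(2) by simp
  then have "wp (sub ?N) = wp (a1 @ a2 @ [?s]) \<otimes> wp (sub ?B)"
    using words unfolding N by (subst word_prod_append) auto
  also have "\<dots> = \<rho>"
    using a(2) I(3) words unfolding K by simp
  finally have "insert j (I - {p}) \<in> facets"
    using facet_flipI[OF assms(1,3), of j] j(1) by blast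
  then show ?thesis
    using j(1) by auto
qed

text \<open>Both flips delete a letter from the same word, so \<open>q\<^sub>j c = c q\<^sub>k\<close> for the factor \<open>c\<close> between
  them; then both letters cancel from the reduced word of \<open>I\<close>.\<close>

lemma not_two_flips:
  assumes "I \<in> facets" "i \<in> I" "j \<notin> I" "k \<notin> I" "j < k" "i < j \<or> k < i"
    "insert j (I - {i}) \<in> facets" "insert k (I - {i}) \<in> facets"
  shows False
proof -
  let ?K = "positions - I"
  let ?X = "insert i ?K" and ?s = "Q ! (j - 1)" and ?t = "Q ! (k - 1)"
  have I: "I \<subseteq> positions" "reduced (sub ?K)"
    and wp: "wp (sub (positions - insert j (I - {i}))) = wp (sub (positions - insert k (I - {i})))"
    and jk: "j \<in> positions" "k \<in> positions"
    using assms(1,7,8) by (auto simp: facet_iff)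
  have st: "?s \<in> S" "?t \<in> S"
    using jk nth_in_S by blast+
  define C where "C = ?K \<inter> {j<..<k}"
  have sub_word: "sub A \<in> lists S" if "A \<subseteq> ?X" for A
    using that I(1) assms(2) by (intro sub_in_lists) auto
  have "positions - insert j (I - {i}) = ?X - {j}" "positions - insert k (I - {i}) = ?X - {k}"
    using assms(2,3,4) I(1) by auto
  then have eq: "wp (sub (?X - {j})) = wp (sub (?X - {k}))"
    using wp by simp
  let ?A = "?X \<inter> {..<j}" and ?D = "?X \<inter> {k<..}"
  \<comment> \<open>Because \<open>i\<close> does not lie between \<open>j\<close> and
    \<open>k\<close>, the middle factor \<open>C\<close> is the same here as in the word of
    \<open>I\<close>.\<close>
  have "(?X - {j}) \<inter> {..<j} = ?A" "(?X - {j}) \<inter> {j<..} \<inter> {..<k} = C"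
    "(?X - {j}) \<inter> {j<..} \<inter> {k<..} = ?D"
    using assms(5,6) by (auto simp: C_def)
  then have Xj: "sub (?X - {j}) = sub ?A @ sub C @ ?t # sub ?D"
    using subword_at_split_notin[of "?X - {j}" j Q] subword_at_split[of "(?X - {j}) \<inter> {j<..}" k Q]
      assms(4,5) jk by auto
  have "(?X - {k}) \<inter> {..<j} = ?A" "(?X - {k}) \<inter> {j<..} \<inter> {..<k} = C"
    "(?X - {k}) \<inter> {j<..} \<inter> {k<..} = ?D"
    using assms(5,6) by (auto simp: C_def)
  then have Xk: "sub (?X - {k}) = sub ?A @ ?s # sub C @ sub ?D"
    using subword_at_split[of "?X - {k}" j Q] subword_at_split_notin[of "(?X - {k}) \<inter> {j<..}" k Q]
      assms(3,5) jk by auto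
  have "?K \<inter> {j<..} \<inter> {..<k} = C" "?K \<inter> {j<..} \<inter> {k<..} = ?K \<inter> {k<..}"
    using assms(5) by (auto simp: C_def)
  then have "sub ?K = sub (?K \<inter> {..<j}) @ ?s # sub C @ ?t # sub (?K \<inter> {k<..})"
    using subword_at_split[of ?K j Q] subword_at_split[of "?K \<inter> {j<..}" k Q] assms(3,4,5) jk
    by auto
  then have no: "?s \<otimes> wp (sub C) \<noteq> wp (sub C) \<otimes> ?t"
    using reduced_no_cancel I(2) by metis
  have "C \<subseteq> ?X"
    by (auto simp: C_def)
  then have w: "sub ?A \<in> lists S" "sub C \<in> lists S" "sub ?D \<in> lists S"
    by (simp_all add: sub_word)
  then have carrier: "wp (sub ?A) \<in> carrier W" "wp (sub C) \<in> carrier W" "wp (sub ?D) \<in> carrier W"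
    by simp_all
  have "wp (sub ?A) \<otimes> (wp (sub C) \<otimes> ?t \<otimes> wp (sub ?D)) =
      wp (sub ?A) \<otimes> (?s \<otimes> wp (sub C) \<otimes> wp (sub ?D))"
    using eq w st unfolding Xj Xk by (simp add: m_assoc)
  then have "wp (sub C) \<otimes> ?t = ?s \<otimes> wp (sub C)"
    using carrier S_closed[OF st(1)] S_closed[OF st(2)] by simp
  then show False
    using no by simp
qed

lemma finite_facets: "finite facets"
  by (rule finite_subset[of _ "Pow positions"]) (auto simp: subword_facets_def)

lemma finite_facet: "I \<in> facets \<Longrightarrow> finite I"
  using finite_subset by (auto simp: subword_facets_def)

sublocale inc: flip_family facets "(<)"
proof
  fix I i j k
  assume "I \<in> facets" "i \<in> I" "j \<notin> I" "k \<notin> I" "i < j" "i < k"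
    "insert j (I - {i}) \<in> facets" "insert k (I - {i}) \<in> facets"
  then show "j = k"
    using not_two_flips[of I i j k] not_two_flips[of I i k j] by (metis nat_neq_iff)
next
  fix I J p
  assume "I \<in> facets" "J \<in> facets" "p \<in> I" "p \<notin> J" "\<And>q. q < p \<Longrightarrow> q \<in> I \<longleftrightarrow> q \<in> J"
  then show "\<exists>j. p < j \<and> j \<notin> I \<and> insert j (I - {p}) \<in> facets"
    using increasing_flip_at_first_difference[of I J p] by auto
qed (use finite_facets finite_facet in auto)

text \<open>Its flips are the arcs of the increasing flip graph run backwards, so its sink is the
  source of that graph.\<close>

sublocale dec: flip_family facets "(>)"
proof
  fix I i j k
  assume "I \<in> facets" "i \<in> I" "j \<notin> I" "k \<notin> I" "i > j" "i > k"
    "insert j (I - {i}) \<in> facets" "insert k (I - {i}) \<in> facets"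
  then show "j = k"
    \<comment> \<open>Here \<open>i\<close> exceeds both \<open>j\<close> and \<open>k\<close>, so
      the second disjunct of \<open>i < j \<or> k < i\<close> holds; the increasing case uses the
      first.\<close>
    using not_two_flips[of I i j k] not_two_flips[of I i k j] by (metis nat_neq_iff)
next
  fix I J p
  assume "I \<in> facets" "J \<in> facets" "p \<in> I" "p \<notin> J" "\<And>q. q > p \<Longrightarrow> q \<in> I \<longleftrightarrow> q \<in> J"
  then show "\<exists>j. p > j \<and> j \<notin> I \<and> insert j (I - {p}) \<in> facets"
    using decreasing_flip_at_last_difference[of I J p] by auto
qed (use finite_facets finite_facet in auto)

section \<open>Rising paths in the increasing flip graph\<close>

abbreviation graph :: "nat set pair_pre_digraph" where
  "graph \<equiv> increasing_flip_graph W S Q \<rho>"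

lemma pverts_graph: "pverts graph = facets"
  by (simp add: increasing_flip_graph_def)

lemma arc_iff_inc_flip: "(I, J) \<in> parcs graph \<longleftrightarrow> inc.flip I J"
  by (simp add: increasing_flip_graph_def inc.flip_def)

lemma arc_iff_dec_flip: "(I, J) \<in> parcs graph \<longleftrightarrow> dec.flip J I"
  by (auto simp: increasing_flip_graph_def dec.flip_def)

lemma p_label_eq: "(I, J) \<in> parcs graph \<Longrightarrow> p_label (I, J) = inc.flipped (I, J)"
  unfolding arc_iff_inc_flip
proof (erule inc.flipE)
  fix i j
  assume *: "i \<in> I" "i \<notin> J" "j \<in> J" "j \<notin> I" "i < j" "J = insert j (I - {i})"
    "inc.flipped (I, J) = i"
  have "(THE i. i \<in> I \<and> (\<exists>j\<in>J. I - {i} = J - {j} \<and> i < j)) = i"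
  proof (rule the_equality)
    have "I - {i} = J - {j}"
      using * by blast
    then show "i \<in> I \<and> (\<exists>j\<in>J. I - {i} = J - {j} \<and> i < j)"
      using * by blast
  next
    fix i' assume "i' \<in> I \<and> (\<exists>j\<in>J. I - {i'} = J - {j} \<and> i' < j)"
    then show "i' = i"
      using * by blast
  qed
  then show ?thesis
    using *(7) by (simp add: p_label_def)
qed

lemma n_label_eq: "(I, J) \<in> parcs graph \<Longrightarrow> n_label (I, J) = dec.flipped (J, I)"
  unfolding arc_iff_dec_flip
proof (erule dec.flipE)
  fix j i
  assume *: "j \<in> J" "j \<notin> I" "i \<in> I" "i \<notin> J" "i < j" "I = insert i (J - {j})"
    "dec.flipped (J, I) = j"
  have "(THE j. j \<in> J \<and> (\<exists>i\<in>I. I - {i} = J - {j} \<and> i < j)) = j"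
  proof (rule the_equality)
    have "I - {i} = J - {j}"
      using * by blast
    then show "j \<in> J \<and> (\<exists>i\<in>I. I - {i} = J - {j} \<and> i < j)"
      using * by blast
  next
    fix j' assume "j' \<in> J \<and> (\<exists>i\<in>I. I - {i} = J - {j'} \<and> i < j')"
    then show "j' = j"
      using * by blast
  qed
  then show ?thesis
    using *(7) by (simp add: n_label_def)
qed

lemma inc_walk_iff:
  "inc.walk I es J \<longleftrightarrow> I \<in> facets \<and> set es \<subseteq> parcs graph \<and> pcas I es J"
proof (induction es arbitrary: I)
  case (Cons e es)
  show ?case
    using arc_iff_inc_flip[of "fst e" "snd e"] Cons[of "snd e"] by (auto simp: inc.flip_def)
qed auto

lemma dec_walk_snoc:
  "dec.walk I (es @ [(K, J)]) J' \<longleftrightarrow> dec.walk I es K \<and> dec.flip K J \<and> J = J'"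
  by (induction es arbitrary: I) (auto simp: dec.flip_def)

text \<open>A walk for the reversed order runs against the arcs, hence both the list and each pair
  in it are reversed.\<close>

lemma dec_walk_iff:
  "dec.walk J (rev (map prod.swap es)) I \<longleftrightarrow> I \<in> facets \<and> set es \<subseteq> parcs graph \<and> pcas I es J"
proof (induction es arbitrary: I)
  case (Cons e es)
  show ?case
    using arc_iff_dec_flip[of "fst e" "snd e"] Cons[of "snd e"] dec_walk_snoc[of J _ "snd e" "fst e" I]
    by (auto simp: dec.flip_def prod.swap_def)
qed auto

lemma pawalk_verts_eq_heads: "pcas I es J \<Longrightarrow> pawalk_verts I es = I # map snd es"
  by (induction es arbitrary: I) auto

lemma pawalk_verts_eq_tails: "pcas I es J \<Longrightarrow> pawalk_verts I es = map fst es @ [J]"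
  by (induction es arbitrary: I) auto

lemma is_rising_path_p_label:
  "is_rising_path graph p_label I es J \<longleftrightarrow> inc.rising I es J"
proof (cases "inc.walk I es J")
  case True
  then have *: "I \<in> facets" "set es \<subseteq> parcs graph" "pcas I es J"
    by (simp_all add: inc_walk_iff)
  have "map p_label es = map inc.flipped es"
    using *(2) p_label_eq by (intro map_cong) auto
  then have "sorted_wrt (<) (map p_label es) \<longleftrightarrow> sorted_wrt (<) (map inc.flipped es)"
    by (rule arg_cong)
  then show ?thesis
    using True * inc.rising_distinct[of I es J]
    by (auto simp: is_rising_path_def inc.rising_def pre_digraph.apath_def pre_digraph.awalk_def
        cas_with_proj_eq awalk_verts_with_proj_eq pverts_graph pawalk_verts_eq_heads)
next
  case False
  then show ?thesis
    unfolding inc_walk_iff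
    by (auto simp: is_rising_path_def inc.rising_def inc_walk_iff pre_digraph.apath_def
        pre_digraph.awalk_def cas_with_proj_eq pverts_graph)
qed

text \<open>Reversing the list turns labels that increase along the path into labels sorted by
  \<open>>\<close>, which is rising for the reversed family.\<close>

lemma is_rising_path_n_label:
  "is_rising_path graph n_label I es J \<longleftrightarrow> dec.rising J (rev (map prod.swap es)) I"
proof (cases "dec.walk J (rev (map prod.swap es)) I")
  case True
  then have *: "I \<in> facets" "set es \<subseteq> parcs graph" "pcas I es J"
    by (simp_all add: dec_walk_iff)
  have labels: "map n_label es = map (dec.flipped \<circ> prod.swap) es"
    using *(2) n_label_eq by (intro map_cong) auto
  have sorted: "sorted_wrt (>) (map dec.flipped (rev (map prod.swap es))) \<longleftrightarrow>
      sorted_wrt (<) (map n_label es)"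
    unfolding labels by (simp add: rev_map[symmetric] sorted_wrt_rev)
  have "distinct (J # map snd (rev (map prod.swap es))) \<longleftrightarrow> distinct (pawalk_verts I es)"
    using pawalk_verts_eq_tails[OF *(3)] by (auto simp: rev_map[symmetric] comp_def)
  then show ?thesis
    using True * sorted dec.rising_distinct[of J "rev (map prod.swap es)" I]
    unfolding is_rising_path_def dec.rising_def pre_digraph.apath_def pre_digraph.awalk_def
    by (simp only: cas_with_proj_eq awalk_verts_with_proj_eq with_proj_simps pverts_graph) blast
next
  case False
  then show ?thesis
    unfolding dec_walk_iff
    by (auto simp: is_rising_path_def dec.rising_def dec_walk_iff pre_digraph.apath_def
        pre_digraph.awalk_def cas_with_proj_eq pverts_graph)
qed

section \<open>Greedy facets and fathers\<close>

lemma negative_greedy_facet_sink: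
  assumes "facets \<noteq> {}"
  shows "inc.sink (negative_greedy_facet W S Q \<rho>)"
proof -
  have iff: "I \<in> facets \<and> out_arcs graph I = {} \<longleftrightarrow> inc.sink I" for I
    by (auto simp: inc.sink_def out_arcs_def arc_iff_inc_flip)
  have "\<exists>!I. inc.sink I"
    using inc.ex_sink[OF assms] inc.sink_unique by blast
  then show ?thesis
    unfolding negative_greedy_facet_def iff by (rule theI')
qed

text \<open>An arc into \<open>I\<close> is a decreasing flip out of \<open>I\<close>, so the source
  of the graph is the sink of the reversed family.\<close>

lemma positive_greedy_facet_sink:
  assumes "facets \<noteq> {}"
  shows "dec.sink (positive_greedy_facet W S Q \<rho>)"
proof -
  have iff: "I \<in> facets \<and> in_arcs graph I = {} \<longleftrightarrow> dec.sink I" for I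
    by (auto simp: dec.sink_def in_arcs_def arc_iff_dec_flip)
  have "\<exists>!I. dec.sink I"
    using dec.ex_sink[OF assms] dec.sink_unique by blast
  then show ?thesis
    unfolding positive_greedy_facet_def iff by (rule theI')
qed

lemma positive_sink_father_flip:
  assumes "I \<in> facets" "I \<noteq> negative_greedy_facet W S Q \<rho>"
  shows "flips_to W S Q \<rho> I (Min (I - negative_greedy_facet W S Q \<rho>)) (positive_sink_father W S Q \<rho> I)"
proof -
  let ?N = "negative_greedy_facet W S Q \<rho>"
  have sink: "inc.sink ?N"
    using negative_greedy_facet_sink assms(1) by blast
  from inc.first_step_of_rising[OF sink assms]
  obtain es p where es: "inc.rising I es ?N" "\<And>fs. inc.rising I fs ?N \<Longrightarrow> fs = es"
    and flip: "inc.flip I (snd (hd es))" "inc.flipped (I, snd (hd es)) = p"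
    and p: "p \<in> I - ?N" "\<And>q. q \<in> I - ?N \<Longrightarrow> \<not> q < p"
    by metis
  have "rising_path graph p_label I ?N = es"
    unfolding rising_path_def is_rising_path_p_label using es by (rule the_equality)
  then have father: "positive_sink_father W S Q \<rho> I = snd (hd es)"
    by (simp add: positive_sink_father_def)
  have "Min (I - ?N) = p"
    using p finite_facet[OF assms(1)] by (intro Min_eqI) (auto simp: not_less)
  moreover from flip(1) have "flips_to W S Q \<rho> I p (snd (hd es))"
  proof (rule inc.flipE)
    fix i j
    assume *: "i \<in> I" "i \<notin> snd (hd es)" "j \<in> snd (hd es)" "j \<notin> I"
      "snd (hd es) = insert j (I - {i})" "inc.flipped (I, snd (hd es)) = i"
      "I \<in> facets" "snd (hd es) \<in> facets"
    then have "I - {i} = snd (hd es) - {j}"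
      by blast
    then show ?thesis
      using * flip(2) by (auto simp: flips_to_def)
  qed
  ultimately show ?thesis
    using father by simp
qed

lemma negative_source_father_flip:
  assumes "I \<in> facets" "I \<noteq> positive_greedy_facet W S Q \<rho>"
  shows "flips_to W S Q \<rho> I (Max (I - positive_greedy_facet W S Q \<rho>)) (negative_source_father W S Q \<rho> I)"
proof -
  let ?P = "positive_greedy_facet W S Q \<rho>"
  have sink: "dec.sink ?P"
    using positive_greedy_facet_sink assms(1) by blast
  from dec.first_step_of_rising[OF sink assms]
  obtain es p where es: "dec.rising I es ?P" "\<And>fs. dec.rising I fs ?P \<Longrightarrow> fs = es" "es \<noteq> []"
    and flip: "dec.flip I (snd (hd es))" "dec.flipped (I, snd (hd es)) = p"
    and p: "p \<in> I - ?P" "\<And>q. q \<in> I - ?P \<Longrightarrow> \<not> q > p"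
    by metis
  have "rising_path graph n_label ?P I = map prod.swap (rev es)"
    unfolding rising_path_def is_rising_path_n_label
  proof (rule the_equality)
    show "dec.rising I (rev (map prod.swap (map prod.swap (rev es)))) ?P"
      using es(1) by (simp add: rev_map[symmetric] comp_def)
  next
    fix fs assume "dec.rising I (rev (map prod.swap fs)) ?P"
    then have "rev (map prod.swap fs) = es"
      by (rule es(2))
    then show "fs = map prod.swap (rev es)"
      by (auto simp: rev_map[symmetric] comp_def)
  qed
  \<comment> \<open>The last arc of the path is the swapped first arc of the nonempty list
    \<open>es\<close>, so its tail is the set reached by the first decreasing flip from
    \<open>I\<close>.\<close>
  then have father: "negative_source_father W S Q \<rho> I = snd (hd es)"
    using es(3) by (simp add: negative_source_father_def last_map last_rev)
  have "Max (I - ?P) = p"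
    using p finite_facet[OF assms(1)] by (intro Max_eqI) (auto simp: not_less)
  moreover from flip(1) have "flips_to W S Q \<rho> I p (snd (hd es))"
  proof (rule dec.flipE)
    fix i j
    assume *: "i \<in> I" "i \<notin> snd (hd es)" "j \<in> snd (hd es)" "j \<notin> I"
      "snd (hd es) = insert j (I - {i})" "dec.flipped (I, snd (hd es)) = i"
      "I \<in> facets" "snd (hd es) \<in> facets"
    then have "I - {i} = snd (hd es) - {j}"
      by blast
    then show ?thesis
      using * flip(2) by (auto simp: flips_to_def)
  qed
  ultimately show ?thesis
    using father by simp
qed

end

theorem proposition4p14:
  fixes W :: "('a, 'b) monoid_scheme"
    and S :: "'a set"
    and Q :: "'a list"
    and \<rho> :: 'a
    and I :: "nat set"
  assumes "coxeter_system W S"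
    and "finite (carrier W)"
    and "Q \<in> lists S"
    and "\<rho> \<in> carrier W"
    and "I \<in> subword_facets W S Q \<rho>"
  shows "(I \<noteq> negative_greedy_facet W S Q \<rho> \<longrightarrow>
            flips_to W S Q \<rho> I (Min (I - negative_greedy_facet W S Q \<rho>))
              (positive_sink_father W S Q \<rho> I)) \<and>
         (I \<noteq> positive_greedy_facet W S Q \<rho> \<longrightarrow>
            flips_to W S Q \<rho> I (Max (I - positive_greedy_facet W S Q \<rho>))
              (negative_source_father W S Q \<rho> I))"
proof -
  interpret group W
    using assms(1) by (simp add: coxeter_system_def)
  interpret subword_complex W S Q \<rho>
    by unfold_locales (use assms in auto)
  show ?thesis
    using positive_sink_father_flip negative_source_father_flip assms(5) by blast
qed

end
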